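(* Let $T\ge 1$ be an integer and consider a reverse-time Markov process $x_T, x_{T-1},\dots,x_0$ on $\mathbb{R}^d$ with transition densities $p(x_{t-1}\mid x_t)$, $t\in\{1,\dots,T\}$, and marginal densities $p(x_t)$, $t\in\{0,\dots,T\}$. Let $p_{\mathcal{Y}}:\mathbb{R}^d\to[0,\infty)$ be a predefined function and let $h(x_t,t)$, $x_t\in\mathbb{R}^d$, $t\in\{0,\dots,T\}$, be a real-valued function, positive for $t\in\{1,\dots,T\}$, such that $h(x_0,0)=p_{\mathcal{Y}}(x_0)$ for all $x_0$ and $$h(x_t,t)=\int p(x_{t-1}\mid x_t)\,h(x_{t-1},t-1)\,dx_{t-1}\qquad\text{for all } t\in\{1,\dots,T\}\text{ and all } x_t.$$ Define $$p^h(x_{t-1}\mid x_t)=p(x_{t-1}\mid x_t)\,\frac{h(x_{t-1},t-1)}{h(x_t,t)},\qquad t\in\{1,\dots,T\}.$$ Then the process (the "bridge") with transition distributions $p^h(x_{t-1}\mid x_t)$ is also a reverse-time Markov process; that is, each $p^h(\cdot\mid x_t)$ is a probability density on $\mathbb{R}^d$, so that these are the transition densities of a reverse-time Markov process. Moreover, suppose $0<\mathbb{E}_{p(x_0)}[h(x_0,0)]<\infty$. If the distribution of the bridge at time $T$ is set to $$p^h(x_T)=\frac{p(x_T)\,h(x_T,T)}{\mathbb{E}_{p(x_0)}[h(x_0,0)]},$$ then for all $t\in\{0,\dots,T\}$ the distribution of the bridge at time $t$ is $$p^h(x_t)=\frac{p(x_t)\,h(x_t,t)}{\mathbb{E}_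{p(x_0)}[h(x_0,0)]}.$$
   Context: Time is discrete, $t\in\{0,1,\dots,T\}$. All distributions are given by (measurable) densities with respect to Lebesgue measure on $\mathbb{R}^d$, and all functions are measurable. A reverse-time Markov process starts from an initial density at time $T$ and evolves from time $t$ to time $t-1$ according to a transition density $x_{t-1}\mapsto p(x_{t-1}\mid x_t)$ that depends only on $x_t$; its marginal densities satisfy $p(x_{t-1})=\int p(x_{t-1}\mid x_t)\,p(x_t)\,dx_t$. Likewise, $p^h(x_t)$ denotes the marginal density of the bridge at time $t$, so that $p^h(x_{t-1})=\int p^h(x_{t-1}\mid x_t)\,p^h(x_t)\,dx_t$. The function $p_{\mathcal{Y}}(x_0)$ quantifies how likely $x_0$ is to possess some target attributes $\mathcal{Y}$; it is nonnegative and is zero for those $x_0$ without these attributes. $\mathbb{E}_{p(x_0)}[h(x_0,0)]=\int p(x_0)\,h(x_0,0)\,dx_0$. *)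

theory Defs
  imports "HOL-Probability.Probability"
begin

text \<open>
  Densities with values in \<^typ>\<open>ennreal\<close>, as in \<^const>\<open>distributed\<close>: the integral defining a
  marginal density may be infinite on a null set.
\<close>

definition prob_density :: "(real ^ 'd \<Rightarrow> ennreal) \<Rightarrow> bool" where
  "prob_density f \<longleftrightarrow> f \<in> borel_measurable borel \<and> (\<integral>\<^sup>+ x. f x \<partial>lborel) = 1"

text \<open>
  For a transition density \<open>q\<close>, the value \<open>q x y\<close> is the density at the new state \<open>y\<close> given the
  current state \<open>x\<close>.
\<close>

definition transition_density :: "(real ^ 'd \<Rightarrow> real ^ 'd \<Rightarrow> real) \<Rightarrow> bool" where
  "transition_density q \<longleftrightarrow>
     (\<lambda>(x, y). q x y) \<in> borel_measurable (borel \<Otimes>\<^sub>M borel) \<and>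
     (\<forall>x y. 0 \<le> q x y) \<and>
     (\<forall>x. (\<integral>\<^sup>+ y. ennreal (q x y) \<partial>lborel) = 1)"

text \<open>
  Time runs backwards: \<open>q t x y\<close> is the density of the step from state \<open>x\<close> at time \<open>t\<close> to state
  \<open>y\<close> at time \<open>t - 1\<close>, and \<open>f\<close> is the density at time \<open>T\<close>.
\<close>

definition path_density ::
  "nat \<Rightarrow> (nat \<Rightarrow> real ^ 'd \<Rightarrow> real ^ 'd \<Rightarrow> real) \<Rightarrow> (real ^ 'd \<Rightarrow> ennreal) \<Rightarrow> (nat \<Rightarrow> real ^ 'd) \<Rightarrow> ennreal" where
  "path_density T q f w = f (w T) * (\<Prod>t\<in>{1..T}. ennreal (q t (w t) (w (t - 1))))"

text \<open>
  The factorised joint density says that the process starts from \<open>p T\<close> and that, given the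
  states at times \<open>T, \<dots>, t\<close>, the state at time \<open>t - 1\<close> has density \<open>q t (X t)\<close>. Marginal
  densities are determined only up to null sets by the law of the process; the last conjunct
  selects the versions that satisfy the marginal recursion at every point.
\<close>

definition reverse_markov_process ::
  "'w measure \<Rightarrow> (nat \<Rightarrow> 'w \<Rightarrow> real ^ 'd) \<Rightarrow> nat \<Rightarrow> (nat \<Rightarrow> real ^ 'd \<Rightarrow> real ^ 'd \<Rightarrow> real)
     \<Rightarrow> (nat \<Rightarrow> real ^ 'd \<Rightarrow> ennreal) \<Rightarrow> bool" where
  "reverse_markov_process M X T q p \<longleftrightarrow>
     prob_space M \<and>
     (\<forall>t\<in>{1..T}. transition_density (q t)) \<and>
     distributed M (\<Pi>\<^sub>M t\<in>{0..T}. lborel) (\<lambda>w. \<lambda>t\<in>{0..T}. X t w) (path_density T q (p T)) \<and>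
     (\<forall>t\<in>{0..T}. distributed M lborel (X t) (p t)) \<and>
     (\<forall>t\<in>{1..T}. \<forall>y. p (t - 1) y = (\<integral>\<^sup>+ x. ennreal (q t x y) * p t x \<partial>lborel))"

definition bridge_transition ::
  "(nat \<Rightarrow> real ^ 'd \<Rightarrow> real ^ 'd \<Rightarrow> real) \<Rightarrow> (nat \<Rightarrow> real ^ 'd \<Rightarrow> real)
     \<Rightarrow> nat \<Rightarrow> real ^ 'd \<Rightarrow> real ^ 'd \<Rightarrow> real" where
  "bridge_transition q h t x y = q t x y * (h (t - 1) y / h t x)"

text \<open>The expectation of a nonnegative function \<open>g\<close> under the density \<open>f\<close>, possibly infinite.\<close>

definition density_expectation :: "(real ^ 'd \<Rightarrow> ennreal) \<Rightarrow> (real ^ 'd \<Rightarrow> real) \<Rightarrow> ennreal" where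
  "density_expectation f g = (\<integral>\<^sup>+ x. f x * ennreal (g x) \<partial>lborel)"

end

theory Submission
  imports Defs
begin

text \<open>
  Integrating a path density over the state at the last index \<open>T + 1\<close> gives the path density with
  horizon \<open>T\<close> whose initial density is the next marginal; so total masses and one-time marginals of
  a path density follow by induction on the horizon. The formula for the bridge marginals is the
  recursion \<open>p (t - 1) y = \<integral> q t x y * p t x dx\<close> in which the factors \<open>h t x\<close> cancel, and its
  constant does not depend on \<open>t\<close> because \<open>\<integral> p t x * h t x dx\<close> does not, by Tonelli.
\<close>

section \<open>Transport of densities by transition densities\<close>

definition push_density ::
  "(real ^ 'd \<Rightarrow> real ^ 'd \<Rightarrow> real) \<Rightarrow> (real ^ 'd \<Rightarrow> ennreal) \<Rightarrow> real ^ 'd \<Rightarrow> ennreal" where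
  "push_density k f y = (\<integral>\<^sup>+ x. ennreal (k x y) * f x \<partial>lborel)"

text \<open>The recursion runs on the horizon and not on the time \<open>t\<close>, to match the
  elimination of the last index from a path density. The base case ignores \<open>t\<close>; for
  \<open>t > T\<close> the value is therefore the density at time 0, a junk value.\<close>

primrec marginal_density ::
  "(nat \<Rightarrow> real ^ 'd \<Rightarrow> real ^ 'd \<Rightarrow> real) \<Rightarrow> nat \<Rightarrow> (real ^ 'd \<Rightarrow> ennreal) \<Rightarrow> nat \<Rightarrow> real ^ 'd \<Rightarrow> ennreal"
where
  "marginal_density q 0 f t = f"
| "marginal_density q (Suc T) f t =
     (if t = Suc T then f else marginal_density q T (push_density (q (Suc T)) f) t)"

lemma transition_density_measurable:
  assumes "transition_density k" "f \<in> N \<rightarrow>\<^sub>M borel" "g \<in> N \<rightarrow>\<^sub>M borel"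
  shows "(\<lambda>w. ennreal (k (f w) (g w))) \<in> borel_measurable N"
proof -
  have k: "(\<lambda>(x, y). k x y) \<in> borel_measurable (borel \<Otimes>\<^sub>M borel)"
    using assms(1) by (simp add: transition_density_def)
  have "(\<lambda>w. (\<lambda>(x, y). k x y) (f w, g w)) \<in> borel_measurable N"
    using assms(2,3) by (intro measurable_compose[OF _ k] measurable_Pair)
  then show ?thesis by simp
qed

lemma push_density_measurable:
  assumes "transition_density k" "f \<in> borel_measurable borel"
  shows "push_density k f \<in> borel_measurable borel"
proof -
  have "(\<lambda>(y, x). ennreal (k x y) * f x) \<in> borel_measurable (lborel \<Otimes>\<^sub>M lborel)"
    unfolding case_prod_beta
    by (intro borel_measurable_times_ennreal transition_density_measurable[OF assms(1)]
        measurable_compose[OF _ assms(2)]; simp)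
  from lborel.borel_measurable_nn_integral[OF this] show ?thesis
    by (simp add: push_density_def[abs_def])
qed

text \<open>Duality by Tonelli: moving a density forward along \<open>k\<close> amounts to averaging
  the test function \<open>g\<close> over the next state. With \<open>g = 1\<close> it gives
  conservation of mass, with \<open>g\<close> a time slice of \<open>h\<close> the invariance of the
  constant \<open>Z\<close>.\<close>

lemma nn_integral_push_density:
  assumes "transition_density k" "f \<in> borel_measurable borel" "g \<in> borel_measurable borel"
  shows "(\<integral>\<^sup>+ y. push_density k f y * g y \<partial>lborel)
    = (\<integral>\<^sup>+ x. f x * (\<integral>\<^sup>+ y. ennreal (k x y) * g y \<partial>lborel) \<partial>lborel)"
proof -
  have k: "(\<lambda>x. ennreal (k x y)) \<in> borel_measurable lborel"
    "(\<lambda>x. ennreal (k y x)) \<in> borel_measurable lborel" for y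
    by (rule transition_density_measurable[OF assms(1)]; simp)+
  have f: "f \<in> borel_measurable lborel" and g: "g \<in> borel_measurable lborel"
    using assms(2,3) by simp_all
  have m: "(\<lambda>(x, y). ennreal (k x y) * f x * g y) \<in> borel_measurable (lborel \<Otimes>\<^sub>M lborel)"
    unfolding case_prod_beta
    by (intro borel_measurable_times_ennreal transition_density_measurable[OF assms(1)]
        measurable_compose[OF _ assms(2)] measurable_compose[OF _ assms(3)]; simp)
  have "(\<integral>\<^sup>+ y. push_density k f y * g y \<partial>lborel)
      = (\<integral>\<^sup>+ y. \<integral>\<^sup>+ x. ennreal (k x y) * f x * g y \<partial>lborel \<partial>lborel)"
    unfolding push_density_def
    by (intro nn_integral_cong nn_integral_multc[symmetric] borel_measurable_times_ennreal k f)
  also have "\<dots> = (\<integral>\<^sup>+ x. \<integral>\<^sup>+ y. ennreal (k x y) * f x * g y \<partial>lborel \<partial>lborel)"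
    by (rule lborel_pair.Fubini'[OF m])
  also have "\<dots> = (\<integral>\<^sup>+ x. \<integral>\<^sup>+ y. f x * (ennreal (k x y) * g y) \<partial>lborel \<partial>lborel)"
    by (simp only: mult_ac)
  also have "\<dots> = (\<integral>\<^sup>+ x. f x * (\<integral>\<^sup>+ y. ennreal (k x y) * g y \<partial>lborel) \<partial>lborel)"
    by (intro nn_integral_cong nn_integral_cmult borel_measurable_times_ennreal k g)
  finally show ?thesis .
qed

lemma nn_integral_push_density_1:
  assumes "transition_density k" "f \<in> borel_measurable borel"
  shows "(\<integral>\<^sup>+ y. push_density k f y \<partial>lborel) = (\<integral>\<^sup>+ x. f x \<partial>lborel)"
  using nn_integral_push_density[OF assms, of "\<lambda>_. 1"] assms(1)
  by (simp add: transition_density_def)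

section \<open>Integrals and marginals of path densities\<close>

lemma path_density_measurable:
  assumes "\<forall>t\<in>{1..T}. transition_density (q t)" "f \<in> borel_measurable borel"
  shows "path_density T q f \<in> borel_measurable (\<Pi>\<^sub>M t\<in>{0..T}. lborel)"
proof -
  have c: "(\<lambda>w. w t) \<in> (\<Pi>\<^sub>M t\<in>{0..T}. lborel) \<rightarrow>\<^sub>M borel" if "t \<le> T" for t
    using measurable_component_singleton[of t "{0..T}" "\<lambda>_. lborel"] that by simp
  show ?thesis
    unfolding path_density_def[abs_def]
    using assms(1)
    by (intro borel_measurable_times_ennreal borel_measurable_prod_ennreal measurable_compose[OF c assms(2)]
        transition_density_measurable c) auto
qed

text \<open>The coordinate \<open>w (Suc T)\<close> enters only through \<open>f\<close> and the
  factor \<open>q (Suc T)\<close>, so Tonelli isolates an inner integral that is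
  \<open>push_density\<close> at \<open>w T\<close>. The condition \<open>g_upd\<close> says that
  \<open>g\<close> ignores this coordinate; the same \<open>g\<close> then makes sense on both
  product spaces.\<close>

lemma nn_integral_path_density_Suc:
  fixes g :: "(nat \<Rightarrow> real ^ 'd) \<Rightarrow> ennreal"
  assumes q: "\<forall>t\<in>{1..Suc T}. transition_density (q t)" and f: "f \<in> borel_measurable borel"
    and g: "g \<in> borel_measurable (\<Pi>\<^sub>M t\<in>{0..Suc T}. lborel)"
    and g_upd: "\<And>w x. g (w(Suc T := x)) = g w"
  shows "(\<integral>\<^sup>+ w. path_density (Suc T) q f w * g w \<partial>(\<Pi>\<^sub>M t\<in>{0..Suc T}. lborel))
    = (\<integral>\<^sup>+ w. path_density T q (push_density (q (Suc T)) f) w * g w \<partial>(\<Pi>\<^sub>M t\<in>{0..T}. lborel))"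
proof -
  interpret product_sigma_finite "\<lambda>_::nat. lborel :: (real ^ 'd) measure" ..
  define R where "R w = (\<Prod>t\<in>{1..T}. ennreal (q t (w t) (w (t - 1))))" for w
  have k: "transition_density (q (Suc T))" using q by simp
  have ins: "{0..Suc T} = insert (Suc T) {0..T}" by auto
  \<comment> \<open>The factors in \<open>R\<close> read the indices 0 to \<open>T\<close> only, so
    \<open>R\<close> is a constant for the integral over the coordinate
    \<open>Suc T\<close>.\<close>
  have R_upd: "R (w(Suc T := x)) = R w" for w x
    unfolding R_def by (intro prod.cong) auto
  have split: "path_density (Suc T) q f (w(Suc T := x)) * g (w(Suc T := x))
      = ennreal (q (Suc T) x (w T)) * f x * (R w * g w)" for w x
    unfolding g_upd using R_upd[of w x]
    by (simp add: path_density_def R_def mult_ac)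
  have kf: "(\<lambda>x. ennreal (q (Suc T) x y) * f x) \<in> borel_measurable lborel" for y
    using f transition_density_measurable[OF k, of "\<lambda>x. x" borel "\<lambda>_. y"] by simp
  have "(\<integral>\<^sup>+ w. path_density (Suc T) q f w * g w \<partial>(\<Pi>\<^sub>M t\<in>{0..Suc T}. lborel))
      = (\<integral>\<^sup>+ w. \<integral>\<^sup>+ x. path_density (Suc T) q f (w(Suc T := x)) * g (w(Suc T := x)) \<partial>lborel
          \<partial>(\<Pi>\<^sub>M t\<in>{0..T}. lborel))"
    using borel_measurable_times_ennreal[OF path_density_measurable[OF q f] g]
    unfolding ins by (intro product_nn_integral_insert) auto
  also have "\<dots> = (\<integral>\<^sup>+ w. push_density (q (Suc T)) f (w T) * (R w * g w) \<partial>(\<Pi>\<^sub>M t\<in>{0..T}. lborel))"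
    unfolding split push_density_def by (intro nn_integral_cong nn_integral_multc kf)
  finally show ?thesis
    by (simp add: path_density_def R_def mult_ac)
qed

text \<open>Each elimination of the last index replaces \<open>f\<close> by its push, which has the
  same mass, until one coordinate is left. The mass of \<open>f\<close> is arbitrary, so that
  \<open>f\<close> may also carry a test function as a factor.\<close>

lemma nn_integral_path_density:
  fixes f :: "real ^ 'd \<Rightarrow> ennreal"
  assumes "\<forall>t\<in>{1..T}. transition_density (q t)" "f \<in> borel_measurable borel"
  shows "(\<integral>\<^sup>+ w. path_density T q f w \<partial>(\<Pi>\<^sub>M t\<in>{0..T}. lborel)) = (\<integral>\<^sup>+ x. f x \<partial>lborel)"
  using assms
proof (induction T arbitrary: f)
  case 0
  interpret product_sigma_finite "\<lambda>_::nat. lborel :: (real ^ 'd) measure" ..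
  show ?case
    using product_nn_integral_singleton[of f 0] 0 by (simp add: path_density_def)
next
  case (Suc T)
  have k: "transition_density (q (Suc T))" using Suc.prems(1) by simp
  show ?case
    using nn_integral_path_density_Suc[OF Suc.prems, of "\<lambda>_. 1"]
      Suc.IH[OF _ push_density_measurable[OF k Suc.prems(2)]] Suc.prems(1)
      nn_integral_push_density_1[OF k Suc.prems(2)]
    by simp
qed

text \<open>As long as \<open>t\<close> lies below the last index, that index can be integrated out
  without touching \<open>g (w t)\<close>. Once \<open>t\<close> is the last index, the density
  reached there is the marginal.\<close>

lemma nn_integral_path_density_marginal:
  fixes f :: "real ^ 'd \<Rightarrow> ennreal"
  assumes "\<forall>t\<in>{1..T}. transition_density (q t)" "f \<in> borel_measurable borel"
    and "g \<in> borel_measurable borel" "t \<le> T"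
  shows "(\<integral>\<^sup>+ w. path_density T q f w * g (w t) \<partial>(\<Pi>\<^sub>M t\<in>{0..T}. lborel))
    = (\<integral>\<^sup>+ x. marginal_density q T f t x * g x \<partial>lborel)"
proof -
  \<comment> \<open>The factor \<open>g (w T)\<close> is absorbed into the initial density, and the
    formula for the total mass applies to \<open>f x * g x\<close>. Horizon and density are left
    general because the induction below changes both.\<close>
  have last: "(\<integral>\<^sup>+ w. path_density T q f w * g (w T) \<partial>(\<Pi>\<^sub>M t\<in>{0..T}. lborel))
      = (\<integral>\<^sup>+ x. f x * g x \<partial>lborel)"
    if "\<forall>t\<in>{1..T}. transition_density (q t)" "f \<in> borel_measurable borel" for T f
  proof -
    have "(\<integral>\<^sup>+ w. path_density T q (\<lambda>x. f x * g x) w \<partial>(\<Pi>\<^sub>M t\<in>{0..T}. lborel))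
        = (\<integral>\<^sup>+ x. f x * g x \<partial>lborel)"
      using that assms(3) by (intro nn_integral_path_density) auto
    then show ?thesis by (simp add: path_density_def mult_ac)
  qed
  show ?thesis
    using assms(1,2,4)
  proof (induction T arbitrary: f)
    case 0
    then show ?case using last[of 0 f] by simp
  next
    case (Suc T)
    show ?case
    proof (cases "t = Suc T")
      case True
      then show ?thesis using last[OF Suc.prems(1,2)] by simp
    next
      case False
      then have t: "t \<le> T" using Suc.prems(3) by simp
      have k: "transition_density (q (Suc T))" using Suc.prems(1) by simp
      have "(\<lambda>w. w t) \<in> (\<Pi>\<^sub>M t\<in>{0..Suc T}. lborel) \<rightarrow>\<^sub>M (borel :: (real ^ 'd) measure)"
        using measurable_component_singleton[of t "{0..Suc T}" "\<lambda>_. lborel"] t by simp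
      then have "(\<integral>\<^sup>+ w. path_density (Suc T) q f w * g (w t) \<partial>(\<Pi>\<^sub>M t\<in>{0..Suc T}. lborel))
        = (\<integral>\<^sup>+ w. path_density T q (push_density (q (Suc T)) f) w * g (w t) \<partial>(\<Pi>\<^sub>M t\<in>{0..T}. lborel))"
        using False
        by (intro nn_integral_path_density_Suc[OF Suc.prems(1,2)] measurable_compose[OF _ assms(3)]) auto
      also have "\<dots> = (\<integral>\<^sup>+ x. marginal_density q T (push_density (q (Suc T)) f) t x * g x \<partial>lborel)"
        using Suc.prems(1) t by (intro Suc.IH push_density_measurable[OF k Suc.prems(2)]) auto
      finally show ?thesis using False by simp
    qed
  qed
qed

lemma marginal_density_measurable:
  assumes "\<forall>t\<in>{1..T}. transition_density (q t)" "f \<in> borel_measurable borel"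
  shows "marginal_density q T f t \<in> borel_measurable borel"
  using assms
proof (induction T arbitrary: f)
  case (Suc T)
  have "marginal_density q T (push_density (q (Suc T)) f) t \<in> borel_measurable borel"
    using Suc.prems by (intro Suc.IH push_density_measurable) auto
  then show ?case using Suc.prems(2) by simp
qed simp

lemma marginal_density_last: "marginal_density q T f T = f"
  by (cases T) auto

text \<open>This turns the recursion on the horizon into one in time. It holds at every point and
  not just almost everywhere, as \<open>reverse_markov_process\<close> demands.\<close>

lemma marginal_density_step:
  assumes "t \<in> {1..T}"
  shows "marginal_density q T f (t - 1) = push_density (q t) (marginal_density q T f t)"
  using assms
proof (induction T arbitrary: f)
  case (Suc T)
  then show ?case
    by (cases "t = Suc T") (auto simp: marginal_density_last)
qed simp

section \<open>Existence of a process with given transition densities\<close>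

text \<open>Canonical construction: the sample space is the path space, its measure has the path
  density, and the process consists of the coordinate maps. As the horizon is finite, a density on a
  finite product suffices.\<close>

lemma reverse_markov_process_exists:
  fixes f :: "real ^ 'd \<Rightarrow> ennreal"
  assumes q: "\<forall>t\<in>{1..T}. transition_density (q t)" and "prob_density f"
  shows "\<exists>(N :: (nat \<Rightarrow> real ^ 'd) measure) Y r. reverse_markov_process N Y T q r \<and> r T = f"
proof -
  have f: "f \<in> borel_measurable borel" and f1: "(\<integral>\<^sup>+ x. f x \<partial>lborel) = 1"
    using assms(2) by (auto simp: prob_density_def)
  let ?P = "\<Pi>\<^sub>M t\<in>{0..T}. (lborel :: (real ^ 'd) measure)"
  define N where "N = density ?P (path_density T q f)"
  have pm: "path_density T q f \<in> borel_measurable ?P"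
    by (rule path_density_measurable[OF q f])
  have sN: "sets N = sets ?P" "space N = space ?P" by (simp_all add: N_def)
  have "prob_space N"
    using nn_integral_path_density[OF q f] f1 pm
    by (intro prob_spaceI) (simp add: N_def emeasure_density cong: nn_integral_cong)
  moreover have "distributed N ?P (\<lambda>w. \<lambda>t\<in>{0..T}. w t) (path_density T q f)"
  proof -
    \<comment> \<open>Points of the product space are extensional, so restriction is the identity
      there and the joint law of the coordinates is \<open>N\<close> itself.\<close>
    have r: "(\<lambda>t\<in>{0..T}. w t) = w" if "w \<in> space ?P" for w
      using that by (auto simp: space_PiM PiE_def extensional_restrict)
    have "distr N ?P (\<lambda>w. \<lambda>t\<in>{0..T}. w t) = distr N N (\<lambda>w. w)"
      using r by (intro distr_cong) (auto simp: sN)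
    moreover have "(\<lambda>w. \<lambda>t\<in>{0..T}. w t) \<in> N \<rightarrow>\<^sub>M ?P"
      using measurable_cong[of N "\<lambda>w. \<lambda>t\<in>{0..T}. w t" "\<lambda>w. w" ?P] r
      by (simp add: sN measurable_ident_sets)
    ultimately show ?thesis
      using pm by (simp add: distributed_def) (simp add: N_def)
  qed
  moreover have "distributed N lborel (\<lambda>w. w t) (marginal_density q T f t)" if "t \<in> {0..T}" for t
  proof -
    have c: "(\<lambda>w. w t) \<in> ?P \<rightarrow>\<^sub>M lborel"
      using measurable_component_singleton[of t "{0..T}" "\<lambda>_. lborel"] that by simp
    then have cN: "(\<lambda>w. w t) \<in> N \<rightarrow>\<^sub>M lborel"
      using measurable_cong_sets[OF sN(1) refl] by blast
    have mm: "marginal_density q T f t \<in> borel_measurable lborel"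
      using marginal_density_measurable[OF q f] by simp
    \<comment> \<open>The two measures agree on each Borel set \<open>A\<close> by the marginal
      formula with \<open>g = indicator A\<close>.\<close>
    have "distr N lborel (\<lambda>w. w t) = density lborel (marginal_density q T f t)"
    proof (rule measure_eqI)
      fix A assume "A \<in> sets (distr N lborel (\<lambda>w. w t))"
      then have A: "A \<in> sets lborel" by simp
      have "emeasure (distr N lborel (\<lambda>w. w t)) A = (\<integral>\<^sup>+ w. indicator A (w t) \<partial>N)"
        using A cN nn_integral_distr[OF cN, of "indicator A"] by simp
      also have "\<dots> = (\<integral>\<^sup>+ w. path_density T q f w * indicator A (w t) \<partial>?P)"
        unfolding N_def using A by (intro nn_integral_density pm measurable_compose[OF c]) auto
      also have "\<dots> = (\<integral>\<^sup>+ x. marginal_density q T f t x * indicator A x \<partial>lborel)"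
        using A that by (intro nn_integral_path_density_marginal[OF q f]) auto
      also have "\<dots> = emeasure (density lborel (marginal_density q T f t)) A"
        using A by (simp add: emeasure_density[OF mm])
      finally show "emeasure (distr N lborel (\<lambda>w. w t)) A
        = emeasure (density lborel (marginal_density q T f t)) A" .
    qed simp
    then show ?thesis using cN mm by (simp add: distributed_def)
  qed
  ultimately have "reverse_markov_process N (\<lambda>t w. w t) T q (marginal_density q T f)"
    using q marginal_density_step[of _ T q f] marginal_density_last[of q T f]
    by (simp add: reverse_markov_process_def push_density_def)
  then show ?thesis using marginal_density_last by blast
qed

section \<open>The bridge as an h-transform\<close>

text \<open>This is Doob's h-transform: by \<open>h_step\<close> the mass of
  \<open>q t x y * h (t - 1) y\<close> in \<open>y\<close> is \<open>h t x\<close>, a positive real,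
  so division by it normalises.\<close>

lemma transition_density_bridge:
  fixes h :: "nat \<Rightarrow> real ^ 'd \<Rightarrow> real"
  assumes q: "transition_density (q t)"
    and h_meas: "h t \<in> borel_measurable borel" "h (t - 1) \<in> borel_measurable borel"
    and h_pos: "\<And>x. 0 < h t x" and h_nonneg: "\<And>x. 0 \<le> h (t - 1) x"
    and h_step: "\<And>x. ennreal (h t x) = (\<integral>\<^sup>+ y. ennreal (q t x y * h (t - 1) y) \<partial>lborel)"
  shows "transition_density (bridge_transition q h t)"
proof -
  have qm: "(\<lambda>z. q t (fst z) (snd z)) \<in> borel_measurable (borel \<Otimes>\<^sub>M borel)"
    and q0: "0 \<le> q t x y" for x y
    using q by (auto simp: transition_density_def case_prod_beta)
  have qx: "(\<lambda>y. q t x y) \<in> borel_measurable borel" for x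
    using measurable_compose[OF measurable_Pair1'[of x borel borel] qm] by simp
  have "(\<lambda>(x, y). bridge_transition q h t x y) \<in> borel_measurable (borel \<Otimes>\<^sub>M borel)"
    unfolding bridge_transition_def case_prod_beta using h_meas
    by (intro borel_measurable_times borel_measurable_divide qm
        measurable_compose[OF measurable_fst] measurable_compose[OF measurable_snd])
  moreover have "(\<integral>\<^sup>+ y. ennreal (bridge_transition q h t x y) \<partial>lborel) = 1" for x
  proof -
    have "(\<integral>\<^sup>+ y. ennreal (bridge_transition q h t x y) \<partial>lborel)
        = (\<integral>\<^sup>+ y. ennreal (q t x y * h (t - 1) y) / ennreal (h t x) \<partial>lborel)"
      using q0 h_nonneg h_pos
      by (intro nn_integral_cong) (simp add: bridge_transition_def divide_ennreal)
    also have "\<dots> = ennreal (h t x) / ennreal (h t x)"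
      unfolding h_step[of x] using qx h_meas(2) by (intro nn_integral_divide) simp
    also have "\<dots> = 1" using h_pos[of x] by (simp add: divide_ennreal)
    finally show ?thesis .
  qed
  ultimately show ?thesis
    using q0 h_nonneg h_pos
    by (auto simp: transition_density_def bridge_transition_def less_imp_le)
qed

text \<open>Being a reverse-time Markov process is rendered as having transition densities that are
  realised by a process from every initial density. The marginal formula is claimed for any
  realisation and at every point, since the recursion in \<open>reverse_markov_process\<close> fixes
  the versions.\<close>

theorem proposition1:
  fixes T :: nat
    and M :: "'w measure" and X :: "nat \<Rightarrow> 'w \<Rightarrow> real ^ 'd"
    and q :: "nat \<Rightarrow> real ^ 'd \<Rightarrow> real ^ 'd \<Rightarrow> real"
    and p :: "nat \<Rightarrow> real ^ 'd \<Rightarrow> ennreal"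
    and pY :: "real ^ 'd \<Rightarrow> real"
    and h :: "nat \<Rightarrow> real ^ 'd \<Rightarrow> real"
  assumes T: "T \<ge> 1"
    and process: "reverse_markov_process M X T q p"
    and pY_measurable: "pY \<in> borel_measurable borel"
    and pY_nonneg: "\<And>x. 0 \<le> pY x"
    and h_measurable: "\<And>t. t \<in> {0..T} \<Longrightarrow> h t \<in> borel_measurable borel"
    and h_pos: "\<And>t x. t \<in> {1..T} \<Longrightarrow> 0 < h t x"
    and h_0: "\<And>x. h 0 x = pY x"
    and h_step: "\<And>t x. t \<in> {1..T} \<Longrightarrow>
      ennreal (h t x) = (\<integral>\<^sup>+ y. ennreal (q t x y * h (t - 1) y) \<partial>lborel)"
  shows "(\<forall>t\<in>{1..T}. transition_density (bridge_transition q h t)) \<and>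
    (\<forall>f. prob_density f \<longrightarrow>
       (\<exists>(N :: (nat \<Rightarrow> real ^ 'd) measure) Y r.
          reverse_markov_process N Y T (bridge_transition q h) r \<and> r T = f)) \<and>
    (0 < density_expectation (p 0) (h 0) \<and> density_expectation (p 0) (h 0) < \<infinity> \<longrightarrow>
       prob_density (\<lambda>x. p T x * ennreal (h T x) / density_expectation (p 0) (h 0)) \<and>
       (\<forall>(N :: 'v measure) Y ph.
          reverse_markov_process N Y T (bridge_transition q h) ph \<and>
          (\<forall>x. ph T x = p T x * ennreal (h T x) / density_expectation (p 0) (h 0)) \<longrightarrow>
          (\<forall>t\<in>{0..T}. \<forall>x.
             ph t x = p t x * ennreal (h t x) / density_expectation (p 0) (h 0))))"
proof -
  have q: "transition_density (q t)" if "t \<in> {1..T}" for t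
    using process that by (simp add: reverse_markov_process_def)
  have pm: "p t \<in> borel_measurable borel" if "t \<in> {0..T}" for t
    using process that
    by (auto simp: reverse_markov_process_def dest!: bspec distributed_borel_measurable)
  have p_step: "p (t - 1) = push_density (q t) (p t)" if "t \<in> {1..T}" for t
    using process that by (auto simp: reverse_markov_process_def push_density_def)
  \<comment> \<open>At time 0 the function \<open>h\<close> may vanish, and its sign comes from
    \<open>pY\<close>.\<close>
  have h_nonneg: "0 \<le> h t x" if "t \<in> {0..T}" for t x
    using h_pos[of t x] h_0[of x] pY_nonneg[of x] that by (cases "t = 0") auto
  have bridge: "\<forall>t\<in>{1..T}. transition_density (bridge_transition q h t)"
    using q h_measurable h_pos h_nonneg h_step by (intro ballI transition_density_bridge) auto
  define Z where "Z = density_expectation (p 0) (h 0)"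
  \<comment> \<open>Duality moves the push from \<open>p (Suc t)\<close> onto \<open>h t\<close>,
    where \<open>h_step\<close> turns it into \<open>h (Suc t)\<close>; the integral is thus
    constant in time. Its value at \<open>T\<close> shows that \<open>Z\<close> normalises the
    initial density of the bridge.\<close>
  have mass: "(\<integral>\<^sup>+ x. p t x * ennreal (h t x) \<partial>lborel) = Z" if "t \<in> {0..T}" for t
    using that
  proof (induction t)
    case 0
    then show ?case by (simp add: Z_def density_expectation_def)
  next
    case (Suc t)
    have t: "Suc t \<in> {1..T}" using Suc.prems by simp
    have k: "ennreal (q (Suc t) x y * h t y) = ennreal (q (Suc t) x y) * ennreal (h t y)" for x y
      using h_nonneg[of t y] q[OF t] Suc.prems by (simp add: ennreal_mult transition_density_def)
    have "Z = (\<integral>\<^sup>+ y. push_density (q (Suc t)) (p (Suc t)) y * ennreal (h t y) \<partial>lborel)"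
      using Suc.IH Suc.prems p_step[OF t] by simp
    also have "\<dots> = (\<integral>\<^sup>+ x. p (Suc t) x * ennreal (h (Suc t) x) \<partial>lborel)"
      using h_step[OF t] q[OF t] pm[of "Suc t"] h_measurable[of t] Suc.prems
      by (subst nn_integral_push_density) (auto simp: k)
    finally show ?case by simp
  qed
  have "prob_density (\<lambda>x. p T x * ennreal (h T x) / Z)" if "0 < Z" "Z < \<infinity>"
    using that pm[of T] h_measurable[of T] mass[of T]
    by (auto simp: prob_density_def nn_integral_divide)
  moreover have "ph t x = p t x * ennreal (h t x) / Z"
    if process': "reverse_markov_process N Y T (bridge_transition q h) ph"
      and last: "\<forall>x. ph T x = p T x * ennreal (h T x) / Z" and t: "t \<in> {0..T}"
    for N :: "'v measure" and Y ph t x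
  proof -
    have "t \<le> T" using t by simp
    \<comment> \<open>Induction downwards from \<open>T\<close>, in the direction of the process.
      The state \<open>x\<close> is arbitrary because the recursion integrates over all states at
      time \<open>Suc t\<close>.\<close>
    then show ?thesis
    proof (induction t arbitrary: x rule: inc_induct)
      case base
      then show ?case using last by simp
    next
      case (step t)
      have t: "Suc t \<in> {1..T}" using step.hyps by simp
      have qm: "(\<lambda>y. ennreal (q (Suc t) y x)) \<in> borel_measurable borel"
        using transition_density_measurable[OF q[OF t], of "\<lambda>x. x" borel "\<lambda>_. x"] by simp
      \<comment> \<open>The denominator \<open>h (Suc t) y\<close> of the bridge transition meets
        the same factor in the formula for \<open>ph (Suc t) y\<close>. What remains of
        \<open>h\<close> is \<open>h t x / Z\<close>, which is free of \<open>y\<close> and leaves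
        the integral.\<close>
      have cancel: "ennreal (bridge_transition q h (Suc t) y x) * (p (Suc t) y * ennreal (h (Suc t) y) / Z)
          = ennreal (q (Suc t) y x) * p (Suc t) y * (ennreal (h t x) / Z)" for y
      proof -
        have pos: "0 < h (Suc t) y" "0 \<le> h t x" "0 \<le> q (Suc t) y x"
          using h_pos[OF t] h_nonneg[of t x] q[OF t] step.hyps by (auto simp: transition_density_def)
        \<comment> \<open>The cancellation is carried out among real numbers;
          \<open>p (Suc t) y\<close>, which may be infinite, is multiplied in afterwards.\<close>
        have "ennreal (bridge_transition q h (Suc t) y x) * ennreal (h (Suc t) y)
            = ennreal (q (Suc t) y x) * ennreal (h t x)"
          using pos by (simp add: bridge_transition_def flip: ennreal_mult)
        then have "ennreal (bridge_transition q h (Suc t) y x) * ennreal (h (Suc t) y) * (p (Suc t) y / Z)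
            = ennreal (q (Suc t) y x) * ennreal (h t x) * (p (Suc t) y / Z)"
          by (rule arg_cong)
        then show ?thesis by (simp only: divide_ennreal_def mult_ac)
      qed
      have "ph t x = (\<integral>\<^sup>+ y. ennreal (bridge_transition q h (Suc t) y x) * ph (Suc t) y \<partial>lborel)"
        using process' t unfolding reverse_markov_process_def by fastforce
      also have "\<dots> = (\<integral>\<^sup>+ y. ennreal (q (Suc t) y x) * p (Suc t) y * (ennreal (h t x) / Z) \<partial>lborel)"
        unfolding step.IH cancel ..
      also have "\<dots> = push_density (q (Suc t)) (p (Suc t)) x * (ennreal (h t x) / Z)"
        unfolding push_density_def using qm pm[of "Suc t"] t by (intro nn_integral_multc) auto
      also have "\<dots> = p t x * ennreal (h t x) / Z"
        using p_step[OF t] by (simp add: divide_ennreal_def mult_ac)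
      finally show ?case .
    qed
  qed
  ultimately show ?thesis
    using bridge reverse_markov_process_exists[OF bridge] unfolding Z_def[symmetric] by blast
qed

end
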